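(* If the exponential family $\{\mathcal{P}_{A,\Theta}\}_{A\in\mathcal{A}}$ is projective, then for all $A\subset B$ in $\mathcal{A}$ and all $\theta\in\Theta$, the random variables $T_{B\setminus A}=T_B-T_A$ and $X_A$ are independent under $\mathbb{P}_{B,\theta}$.
   Context: Let $\mathbb{I}$ be a denumerable set and $\mathcal{A}$ a collection of finite subsets of $\mathbb{I}$, partially ordered by inclusion, which is an ideal: subsets of members of $\mathcal{A}$ and unions of two members of $\mathcal{A}$ belong to $\mathcal{A}$. To each $A\in\mathcal{A}$ is attached a countable set $\mathcal{X}_A$, in such a way that for $A\subset B$ in $\mathcal{A}$ one has $\mathcal{X}_B=\mathcal{X}_A\times\mathcal{X}_{B\setminus A}$; points of $\mathcal{X}_B$ are written $(x,y)$ with $x\in\mathcal{X}_A$, $y\in\mathcal{X}_{B\setminus A}$, and $\pi_{B\mapsto A}:\mathcal{X}_B\to\mathcal{X}_A$, $\pi_{B\mapsto A}(x,y)=x$, is the coordinate projection. Let $\Theta\subseteq\mathbb{R}^d$ be a fixed open set. For each $A\in\mathcal{A}$ let $t_A:\mathcal{X}_A\to\mathbb{R}^d$ be a function (the minimal sufficient statistic) such that $z_A(\theta)=\sum_{x\in\mathcal{X}_A}e^{\langle\theta,t_A(x)\rangle}$ is finite for every $\theta\in\Theta$, and let $\mathbb{P}_{A,\theta}$ be the probability distribution on $\mathcal{X}_A$ with mass function $p_{A,\theta}(x)=e^{\langle\theta,t_A(x)\rangle}/z_A(\theta)$. Put $\mathcal{P}_{A,\Theta}=\{\mathbb{P}_{A,\theta}\}_{\theta\in\Theta}$.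 The family $\{\mathcal{P}_{A,\Theta}\}_{A\in\mathcal{A}}$ is projective if for all $A\subset B$ in $\mathcal{A}$ and all $\theta\in\Theta$, $\mathbb{P}_{A,\theta}=\mathbb{P}_{B,\theta}\circ\pi_{B\mapsto A}^{-1}$. For $A\subset B$, write $X_B=(X_A,X_{B\setminus A})\sim\mathbb{P}_{B,\theta}$, so $X_A=\pi_{B\mapsto A}(X_B)$, and $T_B=t_B(X_B)$, $T_A=t_A(X_A)$. The symbol $T_{B\setminus A}$ means $T_B-T_A$ (not the statistic attached to the index set $B\setminus A$). *)

theory Defs
  imports "HOL-Probability.Probability"
begin

definition partition_function :: "'x set \<Rightarrow> ('x \<Rightarrow> 'v::euclidean_space) \<Rightarrow> 'v \<Rightarrow> real" where
  "partition_function S T \<theta> = (\<Sum>\<^sub>\<infinity>x\<in>S. exp (\<theta> \<bullet> T x))"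

definition exp_distribution :: "'x set \<Rightarrow> ('x \<Rightarrow> 'v::euclidean_space) \<Rightarrow> 'v \<Rightarrow> 'x measure" where
  "exp_distribution S T \<theta> =
     point_measure S (\<lambda>x. ennreal (exp (\<theta> \<bullet> T x) / partition_function S T \<theta>))"

lemma prob_space_exp_distribution:
  assumes "S \<noteq> {}" "(\<lambda>x. exp (\<theta> \<bullet> T x)) summable_on S"
  shows "prob_space (exp_distribution S T \<theta>)"
proof
  let ?f = "\<lambda>x. exp (\<theta> \<bullet> T x)"
  let ?z = "partition_function S T \<theta>"
  obtain a where a: "a \<in> S" using assms(1) by blast
  have "?f a = infsum ?f {a}" by simp
  also have "\<dots> \<le> infsum ?f S"
    using a assms(2) by (intro infsum_mono_neutral) (auto simp: less_imp_le)
  finally have z: "?z > 0"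
    unfolding partition_function_def using exp_gt_zero[of "\<theta> \<bullet> T a"] by linarith
  have "(?f has_sum ?z) S"
    unfolding partition_function_def using assms(2) by simp
  then have hs: "((\<lambda>x. ?f x / ?z) has_sum 1) S"
    using z has_sum_cmult_left[of ?f S ?z "inverse ?z"] by (simp add: field_simps)
  have "(\<lambda>x. ?f x / ?z) summable_on S"
    using hs by (rule has_sum_imp_summable)
  then have "Infinite_Sum.abs_summable_on (\<lambda>x. ?f x / ?z) S"
    using z by (simp add: abs_of_pos)
  then have abs: "Infinite_Set_Sum.abs_summable_on (\<lambda>x. ?f x / ?z) S"
    by (rule abs_summable_equivalent[THEN iffD1])
  have "(\<integral>\<^sup>+x. ennreal (?f x / ?z) \<partial>count_space S) = ennreal (infsetsum (\<lambda>x. ?f x / ?z) S)"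
    using abs z by (intro nn_integral_conv_infsetsum) auto
  also have "\<dots> = 1"
    using infsetsum_infsum[OF abs] infsumI[OF hs] by simp
  finally have "(\<integral>\<^sup>+x. ennreal (?f x / ?z) \<partial>count_space S) = 1" .
  then show "emeasure (exp_distribution S T \<theta>) (space (exp_distribution S T \<theta>)) = 1"
    unfolding exp_distribution_def point_measure_def
    by (simp add: emeasure_density cong: nn_integral_cong_simp)
qed

text \<open>
  The library predicate \<open>indep_var\<close> requires both random variables to have the same
  codomain type; the following is its version for two codomain types.
\<close>

definition indep_rv ::
    "'a measure \<Rightarrow> 'b measure \<Rightarrow> ('a \<Rightarrow> 'b) \<Rightarrow> 'c measure \<Rightarrow> ('a \<Rightarrow> 'c) \<Rightarrow> bool" where
  "indep_rv M N X L Y \<longleftrightarrow>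
     X \<in> measurable M N \<and> Y \<in> measurable M L \<and>
     prob_space.indep_set M {X -` S \<inter> space M | S. S \<in> sets N} {Y -` S \<inter> space M | S. S \<in> sets L}"

lemma (in prob_space) indep_rv_iff_indep_var:
  "indep_rv M N X L Y \<longleftrightarrow> indep_var N X L Y"
proof -
  have eq: "(\<lambda>i. {case_bool X Y i -` A \<inter> space M |A. A \<in> sets (case_bool N L i)}) =
    case_bool {X -` S \<inter> space M | S. S \<in> sets N} {Y -` S \<inter> space M | S. S \<in> sets L}"
    by (auto simp: fun_eq_iff split: bool.split)
  show ?thesis
    unfolding indep_rv_def indep_var_def indep_vars_def2 indep_set_def eq
    by (auto simp: all_bool_eq split: bool.split)
qed

text \<open>
  A point of \<open>X A\<close> is a function on \<open>A\<close> (with the value \<open>undefined\<close> outside \<open>A\<close>), the pair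
  \<open>(x, y)\<close> is \<open>merge A (B - A) (x, y)\<close>, and the coordinate projection onto \<open>X A\<close> is
  restriction to \<open>A\<close>. Since the index sets form an ideal, every \<open>X A\<close> is a finite
  product of the sets \<open>X {i}\<close>, \<open>i \<in> A\<close>, so this loses no generality.
\<close>

locale exponential_family =
  fixes I :: "'i set"
    and \<A> :: "'i set set"
    and X :: "'i set \<Rightarrow> ('i \<Rightarrow> 's) set"
    and \<Theta> :: "(real ^ 'd) set"
    and t :: "'i set \<Rightarrow> ('i \<Rightarrow> 's) \<Rightarrow> real ^ 'd"
  assumes index_denumerable: "countable I" "infinite I"
    and ideal_finite: "\<And>A. A \<in> \<A> \<Longrightarrow> finite A \<and> A \<subseteq> I"
    and ideal_subset: "\<And>A B. B \<in> \<A> \<Longrightarrow> A \<subseteq> B \<Longrightarrow> A \<in> \<A>"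
    and ideal_union: "\<And>A B. A \<in> \<A> \<Longrightarrow> B \<in> \<A> \<Longrightarrow> A \<union> B \<in> \<A>"
    and space_extensional: "\<And>A. A \<in> \<A> \<Longrightarrow> X A \<subseteq> extensional A"
    and space_countable: "\<And>A. A \<in> \<A> \<Longrightarrow> countable (X A)"
    and space_nonempty: "\<And>A. A \<in> \<A> \<Longrightarrow> X A \<noteq> {}"
    and space_product: "\<And>A B. A \<in> \<A> \<Longrightarrow> B \<in> \<A> \<Longrightarrow> A \<subseteq> B \<Longrightarrow>
          X B = merge A (B - A) ` (X A \<times> X (B - A))"
    and parameters_open: "open \<Theta>"
    and partition_finite: "\<And>A \<theta>. A \<in> \<A> \<Longrightarrow> \<theta> \<in> \<Theta> \<Longrightarrow>
          (\<lambda>x. exp (\<theta> \<bullet> t A x)) summable_on X A"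

definition projective_exp_family ::
    "'i set set \<Rightarrow> ('i set \<Rightarrow> ('i \<Rightarrow> 's) set) \<Rightarrow> 'v::euclidean_space set \<Rightarrow>
     ('i set \<Rightarrow> ('i \<Rightarrow> 's) \<Rightarrow> 'v) \<Rightarrow> bool" where
  "projective_exp_family \<A> X \<Theta> t \<longleftrightarrow>
     (\<forall>A\<in>\<A>. \<forall>B\<in>\<A>. A \<subseteq> B \<longrightarrow> (\<forall>\<theta>\<in>\<Theta>.
        exp_distribution (X A) (t A) \<theta> =
        distr (exp_distribution (X B) (t B) \<theta>) (count_space (X A)) (\<lambda>x. restrict x A)))"

end

theory Submission
  imports Defs "HOL-Complex_Analysis.Conformal_Mappings"
begin

text \<open>
  Write \<open>S\<close> and \<open>C\<close> for the sample spaces over \<open>B\<close> and \<open>A\<close>, \<open>\<pi>\<close> for the projection, \<open>T\<close> and \<open>U\<close> for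
  the two statistics, and \<open>D = T - U \<circ> \<pi>\<close> for the increment. Summing the mass function over the fibre
  of \<open>\<pi>\<close> above \<open>x\<close>, projectivity says that the sum of \<open>exp (\<theta> \<bullet> D \<omega>)\<close> over this fibre is
  the quotient of the two partition functions at \<open>\<theta>\<close>, whatever \<open>x\<close> is. As this holds on an open set of
  parameters, the conditional law of \<open>D\<close> given \<open>\<pi> = x\<close> has near the origin a moment generating function
  independent of \<open>x\<close> (\<open>nn_integral_exp_increment\<close>). Uniqueness of moment generating functions makes
  the conditional law itself independent of \<open>x\<close>, which for the discrete variable \<open>\<pi>\<close> is independence
  of \<open>D\<close> and \<open>\<pi>\<close> (\<open>prob_Int_countable_valued\<close>).

  It suffices to have uniqueness on the line. The increment takes countably many values, so a generic
  linear functional \<open>h\<close> separates them (\<open>ex_inner_inj_on_countable\<close>), and the law of \<open>D\<close> can be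
  recovered from that of \<open>h \<bullet> D\<close>. Its moment generating function is finite on an interval around \<open>0\<close>
  since \<open>\<theta> + s h\<close> remains a parameter for small \<open>s\<close>. A distribution on the line with this
  property has a holomorphic two-sided Laplace transform on a vertical strip around the imaginary
  axis; the values near \<open>0\<close> on the real axis determine those on the imaginary axis, which are the
  characteristic function (\<open>mgf_unique\<close>).
\<close>

section \<open>Uniqueness of moment generating functions\<close>

text \<open>
  For either sign of \<open>x\<close> the function is one of \<open>exp ((a + d) * x)\<close> and \<open>exp ((a - d) * x)\<close>.
\<close>
lemma integrable_exp_times_exp_abs:
  fixes M :: "real measure"
  assumes [measurable_cong]: "sets M = sets borel"
    and "\<And>s. \<bar>s\<bar> < \<epsilon> \<Longrightarrow> integrable M (\<lambda>x. exp (s * x))"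
    and "\<bar>a\<bar> + d < \<epsilon>" "0 \<le> d"
  shows "integrable M (\<lambda>x. exp (a * x) * exp (d * \<bar>x\<bar>))"
proof (rule Bochner_Integration.integrable_bound)
  show "integrable M (\<lambda>x. exp ((a + d) * x) + exp ((a - d) * x))"
    using assms(3,4) by (intro Bochner_Integration.integrable_add assms(2)) auto
  show "AE x in M. norm (exp (a * x) * exp (d * \<bar>x\<bar>))
                    \<le> norm (exp ((a + d) * x) + exp ((a - d) * x))"
    by (intro AE_I2, subst (2) real_norm_def, subst abs_of_pos)
       (auto simp: abs_real_def algebra_simps add_pos_pos simp flip: exp_add)
qed measurable

text \<open>
  Near each point \<open>z0\<close> of the strip, expanding \<open>exp ((w - z0) * x)\<close> and integrating term by term gives
  a power series. The integrable function \<open>exp (Re z0 * x) * exp (cmod (w - z0) * \<bar>x\<bar>)\<close> dominates all partial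
  sums as long as \<open>w\<close> is closer to \<open>z0\<close> than the boundary of the strip.
\<close>
lemma holomorphic_on_laplace_transform:
  fixes M :: "real measure"
  assumes borel [measurable_cong]: "sets M = sets borel"
    and int: "\<And>s. \<bar>s\<bar> < \<epsilon> \<Longrightarrow> integrable M (\<lambda>x. exp (s * x))"
  shows "(\<lambda>z. CLINT x|M. exp (z * complex_of_real x)) holomorphic_on {z. \<bar>Re z\<bar> < \<epsilon>}"
    (is "?F holomorphic_on _")
proof -
  have "?F field_differentiable at z0" if z0: "\<bar>Re z0\<bar> < \<epsilon>" for z0
  proof -
    define r where "r = \<epsilon> - \<bar>Re z0\<bar>"
    define a where "a n = (CLINT x|M. exp (z0 * complex_of_real x) * complex_of_real x ^ n / fact n)" for n
    have "?F holomorphic_on ball z0 r"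
    proof (rule power_series_holomorphic)
      fix w assume w: "w \<in> ball z0 r"
      define u where "u n x = exp (z0 * complex_of_real x) * complex_of_real x ^ n / fact n * (w - z0) ^ n" for n x
      define W where "W x = exp (Re z0 * x) * exp (cmod (w - z0) * \<bar>x\<bar>)" for x
      have [measurable]: "u n \<in> borel_measurable M" for n
        unfolding u_def by measurable
      have W: "integrable M W"
        unfolding W_def using w
        by (intro integrable_exp_times_exp_abs[OF borel int])
           (auto simp: r_def dist_norm norm_minus_commute)
      have norm_u: "norm (u n x) = exp (Re z0 * x) * ((cmod (w - z0) * \<bar>x\<bar>) ^ n / fact n)" for n x
        by (simp add: u_def norm_mult norm_divide norm_power power_mult_distrib)
      have exp_sums: "(\<lambda>n. (cmod (w - z0) * \<bar>x\<bar>) ^ n / fact n) sums exp (cmod (w - z0) * \<bar>x\<bar>)" for x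
        using exp_converges[of "cmod (w - z0) * \<bar>x\<bar>"] by (simp add: field_simps)
      have bound: "(\<Sum>n\<in>N. norm (u n x)) \<le> W x" if "finite N" for N x
      proof -
        have "(\<Sum>n\<in>N. (cmod (w - z0) * \<bar>x\<bar>) ^ n / fact n) \<le> exp (cmod (w - z0) * \<bar>x\<bar>)"
          unfolding sums_unique[OF exp_sums]
          by (rule sum_le_suminf) (use that exp_sums in \<open>auto simp: sums_iff\<close>)
        then show ?thesis
          unfolding norm_u W_def sum_distrib_left[symmetric] by (intro mult_left_mono) auto
      qed
      have u_int: "integrable M (u n)" for n
        by (rule Bochner_Integration.integrable_bound[OF W])
           (use bound[of "{n}"] in \<open>auto simp: W_def\<close>)
      have "(\<lambda>N. CLINT x|M. (\<Sum>n<N. u n x)) \<longlonglongrightarrow> ?F w"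
      proof (rule integral_dominated_convergence[OF _ _ W])
        show "AE x in M. (\<lambda>N. \<Sum>n<N. u n x) \<longlonglongrightarrow> exp (w * complex_of_real x)"
        proof (intro AE_I2)
          fix x
          have "(\<lambda>n. exp (z0 * complex_of_real x) * (((w - z0) * complex_of_real x) ^ n /\<^sub>R fact n))
                  sums (exp (z0 * complex_of_real x) * exp ((w - z0) * complex_of_real x))"
            by (intro sums_mult exp_converges)
          also have "exp (z0 * complex_of_real x) * exp ((w - z0) * complex_of_real x)
                       = exp (w * complex_of_real x)"
            by (simp add: algebra_simps flip: exp_add)
          also have "(\<lambda>n. exp (z0 * complex_of_real x) * (((w - z0) * complex_of_real x) ^ n /\<^sub>R fact n))
                       = (\<lambda>n. u n x)"
            by (auto simp: u_def scaleR_conv_of_real power_mult_distrib divide_inverse mult_ac)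
          finally show "(\<lambda>N. \<Sum>n<N. u n x) \<longlonglongrightarrow> exp (w * complex_of_real x)"
            by (simp add: sums_def)
        qed
        show "AE x in M. norm (\<Sum>n<N. u n x) \<le> W x" for N
          using bound[of "{..<N}"] by (intro AE_I2) (auto intro: order.trans[OF norm_sum])
      qed measurable
      also have "(\<lambda>N. CLINT x|M. (\<Sum>n<N. u n x)) = (\<lambda>N. \<Sum>n<N. a n * (w - z0) ^ n)"
        by (subst Bochner_Integration.integral_sum[OF u_int])
           (simp only: u_def[abs_def] a_def integral_mult_left_zero)
      finally show "(\<lambda>n. a n * (w - z0) ^ n) sums ?F w"
        by (simp add: sums_def)
    qed
    then show ?thesis
      using z0 by (intro holomorphic_on_imp_differentiable_at[of _ "ball z0 r"]) (auto simp: r_def)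
  qed
  then show ?thesis
    by (auto simp: holomorphic_on_def intro: field_differentiable_at_within)
qed

text \<open>
  The two Laplace transforms agree on a real interval, hence on the whole strip by analytic
  continuation, hence on the imaginary axis. There they are the characteristic functions, to which
  Levy's uniqueness theorem applies.
\<close>
theorem mgf_unique:
  fixes M N :: "real measure"
  assumes M: "real_distribution M" and N: "real_distribution N" and "0 < \<epsilon>"
    and int_M: "\<And>s. \<bar>s\<bar> < \<epsilon> \<Longrightarrow> integrable M (\<lambda>x. exp (s * x))"
    and int_N: "\<And>s. \<bar>s\<bar> < \<epsilon> \<Longrightarrow> integrable N (\<lambda>x. exp (s * x))"
    and eq: "\<And>s. \<bar>s\<bar> < \<epsilon> \<Longrightarrow> (LINT x|M. exp (s * x)) = (LINT x|N. exp (s * x))"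
  shows "M = N"
proof (rule Levy_uniqueness[OF M N], rule ext)
  fix \<tau> :: real
  let ?S = "{z. \<bar>Re z\<bar> < \<epsilon>}"
  let ?F = "\<lambda>M z. CLINT x|M. exp (z * complex_of_real x)"
  have S: "?S = {z. Re z < \<epsilon>} \<inter> {z. Re z > - \<epsilon>}" by auto
  have "?F M (\<i> * \<tau>) - ?F N (\<i> * \<tau>) = 0"
  proof (rule analytic_continuation[where f = "\<lambda>z. ?F M z - ?F N z" and S = ?S
        and U = "complex_of_real ` {-\<epsilon><..<\<epsilon>}" and \<xi> = 0])
    show "(\<lambda>z. ?F M z - ?F N z) holomorphic_on ?S"
      using M N
      by (intro holomorphic_on_diff holomorphic_on_laplace_transform int_M int_N
            real_distribution.events_eq_borel)
    show "open ?S"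
      by (intro open_Collect_less continuous_intros)
    show "connected ?S"
      unfolding S by (intro convex_connected convex_Int convex_halfspace_Re_lt convex_halfspace_Re_gt)
    show "0 islimpt complex_of_real ` {-\<epsilon><..<\<epsilon>}"
      unfolding islimpt_approachable
    proof (intro allI impI)
      fix e :: real assume "0 < e"
      then show "\<exists>x'\<in>complex_of_real ` {-\<epsilon><..<\<epsilon>}. x' \<noteq> 0 \<and> dist x' 0 < e"
        using \<open>0 < \<epsilon>\<close> by (intro bexI[OF _ imageI[of "min e \<epsilon> / 2"]]) auto
    qed
    show "?F M z - ?F N z = 0" if "z \<in> complex_of_real ` {-\<epsilon><..<\<epsilon>}" for z
    proof -
      from that obtain s where s: "z = of_real s" "\<bar>s\<bar> < \<epsilon>" by auto
      have "?F L z = of_real (LINT x|L. exp (s * x))" for L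
        by (subst integral_complex_of_real[symmetric]) (simp add: s flip: exp_of_real)
      with eq[OF s(2)] show ?thesis by simp
    qed
  qed (use \<open>0 < \<epsilon>\<close> in auto)
  then show "char M \<tau> = char N \<tau>"
    by (simp add: char_def mult.assoc)
qed

section \<open>Separating countably many points by a linear functional\<close>

text \<open>The excluded \<open>h\<close> form a countable union of hyperplanes, which is a Lebesgue null set.\<close>
lemma ex_inner_nonzero_on_countable:
  fixes C :: "'v::euclidean_space set"
  assumes "countable C" "0 \<notin> C"
  obtains h where "\<And>c. c \<in> C \<Longrightarrow> h \<bullet> c \<noteq> 0"
proof -
  have "negligible (\<Union>c\<in>C. {x. c \<bullet> x = 0})"
    unfolding negligible_iff_null_sets using assms
    by (intro null_sets_UN' ) (auto simp flip: negligible_iff_null_sets intro: negligible_hyperplane)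
  then have "(\<Union>c\<in>C. {x. c \<bullet> x = 0}) \<noteq> UNIV"
    using non_negligible_UNIV by metis
  with that show ?thesis
    by (metis (mono_tags, lifting) UNIV_eq_I UN_I inner_commute mem_Collect_eq)
qed

lemma ex_inner_inj_on_countable:
  fixes C :: "'v::euclidean_space set"
  assumes "countable C"
  obtains h where "inj_on (\<lambda>c. h \<bullet> c) C"
proof -
  have "countable ((\<lambda>(a, b). a - b) ` (C \<times> C) - {0})"
    using assms by auto
  then obtain h where h: "\<And>c. c \<in> (\<lambda>(a, b). a - b) ` (C \<times> C) - {0} \<Longrightarrow> h \<bullet> c \<noteq> 0"
    using ex_inner_nonzero_on_countable by blast
  have "inj_on (\<lambda>c. h \<bullet> c) C"
  proof (rule inj_onI, rule ccontr)
    fix a b assume "a \<in> C" "b \<in> C" "h \<bullet> a = h \<bullet> b" "a \<noteq> b"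
    with h[of "a - b"] show False by (force simp: inner_diff_right)
  qed
  with that show ?thesis by blast
qed

section \<open>Independence from a countably valued variable\<close>

text \<open>
  The hypothesis says that the conditional probability of \<open>G\<close> given \<open>X = x\<close> is the same number \<open>c\<close>
  for all \<open>x\<close>. Stated as a product, it also covers values \<open>x\<close> of probability zero.
  Adding up over \<open>x \<in> C\<close> identifies \<open>c\<close> as the probability of \<open>G\<close>.
\<close>
lemma (in prob_space) prob_Int_countable_valued:
  assumes X: "X \<in> measurable M (count_space C)" and "countable C"
    and G: "G \<in> events" and "S \<subseteq> C"
    and const: "\<And>x. x \<in> C \<Longrightarrow> 
       emeasure M (G \<inter> (X -` {x} \<inter> space M)) = c * emeasure M (X -` {x} \<inter> space M)"
  shows "prob (G \<inter> (X -` S \<inter> space M)) = prob G * prob (X -` S \<inter> space M)"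
proof -
  have sum: "emeasure M (H \<inter> (X -` R \<inter> space M))
        = (\<integral>\<^sup>+x. emeasure M (H \<inter> (X -` {x} \<inter> space M)) \<partial>count_space R)"
    if "H \<in> events" "R \<subseteq> C" for H R
  proof -
    have "H \<inter> (X -` R \<inter> space M) = (\<Union>x\<in>R. H \<inter> (X -` {x} \<inter> space M))" by auto
    moreover have "X -` {x} \<inter> space M \<in> events" if "x \<in> R" for x
      using X \<open>R \<subseteq> C\<close> that by (intro measurable_sets[OF X]) auto
    ultimately show ?thesis
      using that countable_subset[OF that(2) \<open>countable C\<close>]
      by (simp only:, intro emeasure_UN_countable) (auto simp: disjoint_family_on_def)
  qed
  have S: "emeasure M (G \<inter> (X -` R \<inter> space M)) = c * emeasure M (X -` R \<inter> space M)"
    if "R \<subseteq> C" for R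
  proof -
    have "emeasure M (G \<inter> (X -` R \<inter> space M))
            = (\<integral>\<^sup>+x. c * emeasure M (X -` {x} \<inter> space M) \<partial>count_space R)"
      using that by (subst sum[OF G that]) (auto intro!: nn_integral_cong const)
    also have "\<dots> = c * emeasure M (X -` R \<inter> space M)"
      using sum[OF sets.top that] by (simp add: nn_integral_cmult Int_absorb1)
    finally show ?thesis .
  qed
  have "X -` C \<inter> space M = space M"
    using measurable_space[OF X] by auto
  then have "c = emeasure M G"
    using S[of C] G by (simp add: emeasure_space_1 sets.sets_into_space Int_absorb2)
  with S[OF \<open>S \<subseteq> C\<close>] have "ennreal (prob (G \<inter> (X -` S \<inter> space M)))
                              = ennreal (prob G * prob (X -` S \<inter> space M))"
    by (simp add: emeasure_eq_measure ennreal_mult)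
  then show ?thesis
    by (simp add: measure_nonneg)
qed

section \<open>Discrete exponential families\<close>

lemma space_exp_distribution [simp]: "space (exp_distribution S T \<theta>) = S"
  and sets_exp_distribution [simp]: "sets (exp_distribution S T \<theta>) = Pow S"
  by (simp_all add: exp_distribution_def space_point_measure sets_point_measure)

lemma measurable_exp_distribution [simp]:
  "f \<in> measurable (exp_distribution S T \<theta>) N \<longleftrightarrow> f \<in> S \<rightarrow> space N"
  by (simp add: exp_distribution_def)

lemma nn_integral_exp_distribution:
  "(\<integral>\<^sup>+x. f x \<partial>exp_distribution S T \<theta>)
     = (\<integral>\<^sup>+x. ennreal (exp (\<theta> \<bullet> T x) / partition_function S T \<theta>) * f x \<partial>count_space S)"
  unfolding exp_distribution_def point_measure_def by (subst nn_integral_density) auto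

lemma emeasure_exp_distribution_singleton:
  "x \<in> S \<Longrightarrow> emeasure (exp_distribution S T \<theta>) {x}
                = ennreal (exp (\<theta> \<bullet> T x) / partition_function S T \<theta>)"
  unfolding exp_distribution_def by (subst emeasure_point_measure_finite2) auto

lemma partition_function_pos:
  assumes "S \<noteq> {}" "(\<lambda>x. exp (\<theta> \<bullet> T x)) summable_on S"
  shows "0 < partition_function S T \<theta>"
proof -
  obtain a where "a \<in> S" using assms(1) by blast
  then have "exp (\<theta> \<bullet> T a) \<le> partition_function S T \<theta>"
    unfolding partition_function_def
    using finite_sum_le_infsum[OF assms(2), of "{a}"] by simp
  then show ?thesis by (rule less_le_trans[OF exp_gt_zero])
qed

text \<open>
  Reweighting by \<open>exp (\<eta> \<bullet> T x)\<close> moves the parameter from \<open>\<theta>\<close> to \<open>\<theta> + \<eta>\<close> and alters only the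
  normalisation.
\<close>
lemma nn_integral_exponential_tilt:
  assumes "E \<subseteq> S"
    and "0 < partition_function S T \<theta>" "0 < partition_function S T (\<theta> + \<eta>)"
  shows "(\<integral>\<^sup>+x. ennreal (exp (\<eta> \<bullet> T x)) * indicator E x \<partial>exp_distribution S T \<theta>)
           = ennreal (partition_function S T (\<theta> + \<eta>) / partition_function S T \<theta>)
             * emeasure (exp_distribution S T (\<theta> + \<eta>)) E"
proof -
  let ?z = "partition_function S T"
  have "(\<integral>\<^sup>+x. ennreal (exp (\<eta> \<bullet> T x)) * indicator E x \<partial>exp_distribution S T \<theta>)
      = (\<integral>\<^sup>+x. ennreal (?z (\<theta> + \<eta>) / ?z \<theta>)
               * (ennreal (exp ((\<theta> + \<eta>) \<bullet> T x) / ?z (\<theta> + \<eta>)) * indicator E x) \<partial>count_space S)"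
    unfolding nn_integral_exp_distribution using assms(2,3)
    by (intro nn_integral_cong)
       (auto simp: inner_add_left exp_add indicator_def simp flip: ennreal_mult)
  also have "\<dots> = ennreal (?z (\<theta> + \<eta>) / ?z \<theta>) * (\<integral>\<^sup>+x. indicator E x \<partial>exp_distribution S T (\<theta> + \<eta>))"
    by (simp add: nn_integral_cmult nn_integral_exp_distribution)
  also have "(\<integral>\<^sup>+x. indicator E x \<partial>exp_distribution S T (\<theta> + \<eta>)) = emeasure (exp_distribution S T (\<theta> + \<eta>)) E"
    using assms(1) by (intro nn_integral_indicator) auto
  finally show ?thesis .
qed

section \<open>The increment over a projection\<close>

lemma emeasure_exp_distribution_fibre:
  assumes "\<pi> \<in> S \<rightarrow> C"
    and proj: "exp_distribution C U \<theta> = distr (exp_distribution S T \<theta>) (count_space C) \<pi>"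
    and x: "x \<in> C"
  shows "emeasure (exp_distribution S T \<theta>) (\<pi> -` {x} \<inter> S)
           = ennreal (exp (\<theta> \<bullet> U x) / partition_function C U \<theta>)"
proof -
  have "emeasure (exp_distribution S T \<theta>) (\<pi> -` {x} \<inter> S)
          = emeasure (distr (exp_distribution S T \<theta>) (count_space C) \<pi>) {x}"
    using assms(1) x by (subst emeasure_distr) auto
  then show ?thesis
    using emeasure_exp_distribution_singleton[OF x] by (simp flip: proj)
qed

text \<open>
  On the fibre over \<open>x\<close> the increment differs from \<open>T\<close> by the constant \<open>U x\<close>, so exponential tilting
  applies and leaves the factor \<open>exp (- (\<theta>' - \<theta>) \<bullet> U x)\<close>. The fibre has mass proportional to
  \<open>exp (\<theta>' \<bullet> U x)\<close> under \<open>\<theta>'\<close> and to \<open>exp (\<theta> \<bullet> U x)\<close> under \<open>\<theta>\<close>, because the projection is again in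
  the exponential family of \<open>U\<close>. All dependence on \<open>x\<close> therefore cancels: given \<open>\<pi> = x\<close>, the increment
  has a moment generating function that does not see \<open>x\<close>.
\<close>
lemma nn_integral_exp_increment:
  assumes S: "S \<noteq> {}" "\<And>\<eta>. \<eta> \<in> {\<theta>, \<theta>'} \<Longrightarrow> (\<lambda>x. exp (\<eta> \<bullet> T x)) summable_on S"
    and C: "\<And>\<eta>. \<eta> \<in> {\<theta>, \<theta>'} \<Longrightarrow> (\<lambda>x. exp (\<eta> \<bullet> U x)) summable_on C"
    and \<pi>: "\<pi> \<in> S \<rightarrow> C"
    and proj: "\<And>\<eta>. \<eta> \<in> {\<theta>, \<theta>'} \<Longrightarrow>
      exp_distribution C U \<eta> = distr (exp_distribution S T \<eta>) (count_space C) \<pi>"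
    and x: "x \<in> C"
  shows "(\<integral>\<^sup>+\<omega>. ennreal (exp ((\<theta>' - \<theta>) \<bullet> (T \<omega> - U (\<pi> \<omega>)))) * indicator (\<pi> -` {x} \<inter> S) \<omega>
            \<partial>exp_distribution S T \<theta>)
         = ennreal ((partition_function S T \<theta>' / partition_function C U \<theta>')
                    / (partition_function S T \<theta> / partition_function C U \<theta>))
           * emeasure (exp_distribution S T \<theta>) (\<pi> -` {x} \<inter> S)"
proof -
  let ?zS = "partition_function S T" and ?zC = "partition_function C U"
  let ?E = "\<pi> -` {x} \<inter> S"
  have pos: "0 < ?zS \<theta>" "0 < ?zC \<theta>" "0 < ?zS \<theta>'" "0 < ?zC \<theta>'"
    using S C x by (auto intro!: partition_function_pos)
  note fibre = emeasure_exp_distribution_fibre[OF \<pi> proj x]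
  have "(\<integral>\<^sup>+\<omega>. ennreal (exp ((\<theta>' - \<theta>) \<bullet> (T \<omega> - U (\<pi> \<omega>)))) * indicator ?E \<omega> \<partial>exp_distribution S T \<theta>)
      = (\<integral>\<^sup>+\<omega>. ennreal (exp (- ((\<theta>' - \<theta>) \<bullet> U x)))
             * (ennreal (exp ((\<theta>' - \<theta>) \<bullet> T \<omega>)) * indicator ?E \<omega>) \<partial>exp_distribution S T \<theta>)"
    by (intro nn_integral_cong)
       (auto simp: indicator_def inner_diff_right simp flip: ennreal_mult exp_add)
  also have "\<dots> = ennreal (exp (- ((\<theta>' - \<theta>) \<bullet> U x)))
      * (ennreal (?zS \<theta>' / ?zS \<theta>) * emeasure (exp_distribution S T \<theta>') ?E)"
    using nn_integral_exponential_tilt[of ?E S T \<theta> "\<theta>' - \<theta>"] pos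
    by (subst nn_integral_cmult) auto
  also have "\<dots> = ennreal (exp (- ((\<theta>' - \<theta>) \<bullet> U x))
                   * (?zS \<theta>' / ?zS \<theta> * (exp (\<theta>' \<bullet> U x) / ?zC \<theta>')))"
    using pos by (simp add: fibre flip: ennreal_mult)
  also have "exp (- ((\<theta>' - \<theta>) \<bullet> U x)) * (?zS \<theta>' / ?zS \<theta> * (exp (\<theta>' \<bullet> U x) / ?zC \<theta>'))
             = (?zS \<theta>' / ?zC \<theta>') / (?zS \<theta> / ?zC \<theta>) * (exp (\<theta> \<bullet> U x) / ?zC \<theta>)"
    using pos by (simp add: inner_diff_left exp_diff exp_minus field_simps)
  also have "ennreal \<dots> = ennreal ((?zS \<theta>' / ?zC \<theta>') / (?zS \<theta> / ?zC \<theta>))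
                          * emeasure (exp_distribution S T \<theta>) ?E"
    using pos by (simp add: fibre flip: ennreal_mult)
  finally show ?thesis .
qed

text \<open>
  The argument is about a map \<open>\<pi>\<close> that carries one discrete exponential family to another, parameter
  by parameter; a coordinate projection between members of a projective family is an instance. Along
  a separating direction \<open>h\<close> the conditional laws of the increment on the fibres of \<open>\<pi>\<close> have the same
  moment generating function, so they coincide.
\<close>
theorem indep_increment_of_projection:
  fixes \<Theta> :: "'v::euclidean_space set"
  assumes S: "countable S" "S \<noteq> {}" "\<And>\<eta>. \<eta> \<in> \<Theta> \<Longrightarrow> (\<lambda>x. exp (\<eta> \<bullet> T x)) summable_on S"
    and C: "countable C" "\<And>\<eta>. \<eta> \<in> \<Theta> \<Longrightarrow> (\<lambda>x. exp (\<eta> \<bullet> U x)) summable_on C"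
    and \<pi>: "\<pi> \<in> S \<rightarrow> C"
    and proj: "\<And>\<eta>. \<eta> \<in> \<Theta> \<Longrightarrow>
      exp_distribution C U \<eta> = distr (exp_distribution S T \<eta>) (count_space C) \<pi>"
    and \<Theta>: "open \<Theta>" "\<theta> \<in> \<Theta>"
  shows "indep_rv (exp_distribution S T \<theta>) borel (\<lambda>\<omega>. T \<omega> - U (\<pi> \<omega>)) (count_space C) \<pi>"
proof -
  define P where "P = exp_distribution S T \<theta>"
  define D where "D \<omega> = T \<omega> - U (\<pi> \<omega>)" for \<omega>
  define E where "E x = \<pi> -` {x} \<inter> S" for x
  define K where "K \<eta> = (partition_function S T \<eta> / partition_function C U \<eta>)
                        / (partition_function S T \<theta> / partition_function C U \<theta>)" for \<eta>
  interpret prob_space P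
    unfolding P_def using S \<Theta> by (intro prob_space_exp_distribution) auto
  have space_P [simp]: "space P = S" and sets_P [simp]: "events = Pow S"
    and meas_P [simp]: "f \<in> measurable P N \<longleftrightarrow> f \<in> S \<rightarrow> space N" for f and N :: "'z measure"
    by (simp_all add: P_def)
  have meas_real [simp]: "f \<in> measurable P borel" for f :: "_ \<Rightarrow> real"
    by (simp add: P_def)
  have meas_ennreal [simp]: "f \<in> measurable P borel" for f :: "_ \<Rightarrow> ennreal"
    by (simp add: P_def)
  have meas_cond [simp]: "f \<in> measurable (uniform_measure P (E x)) borel" for f :: "_ \<Rightarrow> real" and x
    by (simp add: uniform_measure_def)
  have E_subset [simp]: "E x \<subseteq> S" for x
    by (auto simp: E_def)
  have "C \<noteq> {}" using S(2) \<pi> by auto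
  have E_nonzero: "emeasure P (E x) \<noteq> 0" if "x \<in> C" for x
    using emeasure_exp_distribution_fibre[OF \<pi> proj[OF \<Theta>(2)] that]
      partition_function_pos[OF \<open>C \<noteq> {}\<close> C(2)[OF \<Theta>(2)]]
    by (simp add: P_def E_def ennreal_eq_0_iff not_le)

  \<comment> \<open>\<open>h \<bullet> D\<close> determines \<open>D\<close>, and \<open>\<epsilon>\<close> keeps the segment through \<open>\<theta>\<close> in direction \<open>h\<close> inside \<open>\<Theta>\<close>;
      the \<open>+ 1\<close> allows for \<open>h = 0\<close>, which is possible if \<open>D\<close> is constant.\<close>
  obtain h where h: "inj_on (\<lambda>c. h \<bullet> c) (D ` S)"
    using S(1) by (elim ex_inner_inj_on_countable[OF countable_image])
  obtain e where e: "0 < e" "ball \<theta> e \<subseteq> \<Theta>"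
    using \<Theta> by (elim openE)
  define \<epsilon> where "\<epsilon> = e / (norm h + 1)"
  have "0 < \<epsilon>"
    using e(1) by (simp add: \<epsilon>_def add_nonneg_pos)
  have line: "\<theta> + s *\<^sub>R h \<in> \<Theta>" if "\<bar>s\<bar> < \<epsilon>" for s
  proof -
    have "\<bar>s\<bar> * norm h \<le> \<bar>s\<bar> * (norm h + 1)"
      by (intro mult_left_mono) auto
    also have "\<dots> < e"
      using that by (simp add: \<epsilon>_def pos_less_divide_eq add_nonneg_pos)
    finally show ?thesis
      using e(2) by (auto simp: dist_norm)
  qed

  \<comment> \<open>\<open>L x\<close> is the conditional law of \<open>h \<bullet> D\<close> given \<open>\<pi> = x\<close>.\<close>
  define L where "L x = distr (uniform_measure P (E x)) borel (\<lambda>\<omega>. h \<bullet> D \<omega>)" for x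
  have L: "real_distribution (L x)" if "x \<in> C" for x
    unfolding L_def using E_nonzero[OF that]
    by (intro prob_space.real_distribution_distr prob_space_uniform_measure) auto
  have mgf: "(\<integral>\<^sup>+v. ennreal (exp (s * v)) \<partial>L x) = ennreal (K (\<theta> + s *\<^sub>R h))"
    if "x \<in> C" "\<bar>s\<bar> < \<epsilon>" for x s
  proof -
    have in_\<Theta>: "\<eta> \<in> \<Theta>" if "\<eta> \<in> {\<theta>, \<theta> + s *\<^sub>R h}" for \<eta>
      using that \<Theta>(2) line[OF \<open>\<bar>s\<bar> < \<epsilon>\<close>] by auto
    have "(\<integral>\<^sup>+v. ennreal (exp (s * v)) \<partial>L x)
        = (\<integral>\<^sup>+\<omega>. ennreal (exp ((s *\<^sub>R h) \<bullet> D \<omega>)) \<partial>uniform_measure P (E x))"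
      unfolding L_def by (subst nn_integral_distr) auto
    also have "\<dots> = (\<integral>\<^sup>+\<omega>. ennreal (exp ((s *\<^sub>R h) \<bullet> D \<omega>)) * indicator (E x) \<omega> \<partial>P) / emeasure P (E x)"
      by (intro nn_integral_uniform_measure) (auto simp: E_def)
    also have "(\<integral>\<^sup>+\<omega>. ennreal (exp ((s *\<^sub>R h) \<bullet> D \<omega>)) * indicator (E x) \<omega> \<partial>P)
                 = ennreal (K (\<theta> + s *\<^sub>R h)) * emeasure P (E x)"
      using nn_integral_exp_increment[where \<theta> = \<theta> and \<theta>' = "\<theta> + s *\<^sub>R h",
          OF S(2) S(3)[OF in_\<Theta>] C(2)[OF in_\<Theta>] \<pi> proj[OF in_\<Theta>] that(1)]
      by (simp add: P_def D_def E_def K_def)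
    finally show ?thesis
      using E_nonzero[OF that(1)] by (simp add: ennreal_mult_divide_eq)
  qed
  have int: "integrable (L x) (\<lambda>v. exp (s * v))" if "x \<in> C" "\<bar>s\<bar> < \<epsilon>" for x s
    using mgf[OF that] by (intro integrableI_nonneg) (auto simp: L_def)
  have L_eq: "L x = L y" if "x \<in> C" "y \<in> C" for x y
    using that mgf \<open>0 < \<epsilon>\<close>
    by (intro mgf_unique[of _ _ \<epsilon>] L int)
       (auto simp: integral_eq_nn_integral L_def)

  have fibre: "\<exists>c. \<forall>x\<in>C. emeasure P ((D -` V \<inter> S) \<inter> E x) = c * emeasure P (E x)" for V
  proof -
    \<comment> \<open>The event \<open>D \<in> V\<close> as an event about \<open>h \<bullet> D\<close>; the image of all of \<open>V\<close> need not be Borel,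
        so only the countably many attained values are kept.\<close>
    define W where "W = (\<lambda>c. h \<bullet> c) ` (V \<inter> D ` S)"
    have "countable W"
      using S(1) by (auto simp: W_def)
    then have W: "W \<in> sets borel"
      by (rule sets.countable[rotated]) auto
    have DV: "D -` V \<inter> S = (\<lambda>\<omega>. h \<bullet> D \<omega>) -` W \<inter> S"
      using h by (auto simp: W_def dest: inj_onD)
    have "emeasure P ((D -` V \<inter> S) \<inter> E x) = emeasure (L x) W * emeasure P (E x)" if "x \<in> C" for x
    proof -
      have "emeasure (L x) W = emeasure P (E x \<inter> (D -` V \<inter> S)) / emeasure P (E x)"
        unfolding L_def using W by (subst emeasure_distr) (auto simp: DV)
      then show ?thesis
        using E_nonzero[OF that]
        by (simp add: ennreal_divide_times ennreal_times_divide ennreal_mult_divide_eq Int_commute)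
    qed
    with L_eq \<open>C \<noteq> {}\<close> show ?thesis by (metis all_not_in_conv)
  qed
  have "indep_set {D -` V \<inter> space P | V. V \<in> sets borel} {\<pi> -` R \<inter> space P | R. R \<in> sets (count_space C)}"
  proof (rule indep_setI)
    fix a b
    assume "a \<in> {D -` V \<inter> space P | V. V \<in> sets borel}"
       and "b \<in> {\<pi> -` R \<inter> space P | R. R \<in> sets (count_space C)}"
    then obtain V R where a: "a = D -` V \<inter> S" and b: "b = \<pi> -` R \<inter> space P" "R \<subseteq> C"
      by auto
    obtain c where "\<forall>x\<in>C. emeasure P (a \<inter> E x) = c * emeasure P (E x)"
      using fibre a by blast
    then show "prob (a \<inter> b) = prob a * prob b"
      unfolding b using a b(2) C(1) \<pi>
      by (intro prob_Int_countable_valued) (auto simp: E_def)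
  qed auto
  then show ?thesis
    using \<pi> by (simp add: indep_rv_def P_def D_def[abs_def])
qed

theorem proposition2:
  fixes I :: "'i set"
    and \<A> :: "'i set set"
    and X :: "'i set \<Rightarrow> ('i \<Rightarrow> 's) set"
    and \<Theta> :: "(real ^ 'd) set"
    and t :: "'i set \<Rightarrow> ('i \<Rightarrow> 's) \<Rightarrow> real ^ 'd"
  assumes "exponential_family I \<A> X \<Theta> t"
    and "projective_exp_family \<A> X \<Theta> t"
    and "A \<in> \<A>" and "B \<in> \<A>" and "A \<subseteq> B"
    and "\<theta> \<in> \<Theta>"
  shows "indep_rv (exp_distribution (X B) (t B) \<theta>)
           borel (\<lambda>x. t B x - t A (restrict x A))
           (count_space (X A)) (\<lambda>x. restrict x A)"
proof -
  interpret exponential_family I \<A> X \<Theta> t by fact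
  have "restrict (merge A (B - A) (x, y)) A = x" if "x \<in> X A" for x y
    using space_extensional[OF \<open>A \<in> \<A>\<close>] that
    by (auto simp: extensional_restrict)
  then have "(\<lambda>x. restrict x A) \<in> X B \<rightarrow> X A"
    by (auto simp: space_product[OF \<open>A \<in> \<A>\<close> \<open>B \<in> \<A>\<close> \<open>A \<subseteq> B\<close>])
  then show ?thesis
  proof (rule indep_increment_of_projection[rotated 5])
    show "exp_distribution (X A) (t A) \<eta>
            = distr (exp_distribution (X B) (t B) \<eta>) (count_space (X A)) (\<lambda>x. restrict x A)"
      if "\<eta> \<in> \<Theta>" for \<eta>
      using assms(2-5) that unfolding projective_exp_family_def by blast
  qed (fact space_countable[OF \<open>A \<in> \<A>\<close>] space_countable[OF \<open>B \<in> \<A>\<close>] space_nonempty[OF \<open>B \<in> \<A>\<close>]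
        partition_finite[OF \<open>A \<in> \<A>\<close>] partition_finite[OF \<open>B \<in> \<A>\<close>] parameters_open
        \<open>\<theta> \<in> \<Theta>\<close>)+
qed

end
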